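(* Let $G=(\mathcal{A},\mathcal{E})$ be a finite simple undirected graph and let $V:\mathcal{CS}(G)\to\mathbb{R}$ be an $m+a$ function, $V=V^{+}+V^{-}$ with $V^{+}$ superadditive and $V^{-}$ subadditive. Let $CS_i$ be a feasible coalition structure, regarded as a node of the search tree of $G$, and let $ST(CS_i)$ be the subtree rooted at $CS_i$. Then $M(CS_i)=V^{-}(CS_i)+V^{+}(\overline{CS_i})$ is an upper bound for the value of $V$ at every coalition structure of $ST(CS_i)$, i.e. $$M(CS_i)=V^{-}(CS_i)+V^{+}(\overline{CS_i})\;\ge\;\max\{V(CS_j)\mid CS_j\in ST(CS_i)\}.$$
   Context: Feasibility: a coalition is a nonempty subset $C\subseteq\mathcal{A}$; it is feasible if the subgraph of $G$ induced by $C$ is connected. $\mathcal{FC}(G)$ is the set of feasible coalitions, and $\mathcal{CS}(G)$ is the set of partitions of $\mathcal{A}$ into feasible coalitions (feasible coalition structures). Superadditive/subadditive: a function $v:\mathcal{FC}(G)\to\mathbb{R}$ is superadditive (resp. subadditive) if $v(S\cup T)\ge v(S)+v(T)$ (resp. $\le$) for all disjoint $S,T$ such that $S$, $T$ and $S\cup T$ belong to $\mathcal{FC}(G)$. A function $V:\mathcal{CS}(G)\to\mathbb{R}$ of the form $V(CS)=\sum_{C\in CS}v(C)$ is superadditive (resp. subadditive) if the underlying $v$ is. A function $V:\mathcal{CS}(G)\to\mathbb{R}$ is an $m+a$ function if it is the sum of a superadditive $V^{+}:\mathcal{CS}(G)\to\mathbb{R}$ and a subadditive $V^{-}:\mathcal{CS}(G)\to\mathbb{R}$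 (each of the form $CS\mapsto\sum_{C\in CS}v^{\pm}(C)$ for some $v^{\pm}:\mathcal{FC}(G)\to\mathbb{R}$). 2-coloured graphs: a 2-coloured graph $(\mathcal{V},\mathcal{F},c)$ is a simple undirected graph whose vertices are coalitions partitioning $\mathcal{A}$, with a colouring $c:\mathcal{F}\to\{red,green\}$; it represents the coalition structure $\mathcal{V}$. Contracting a green edge $e=(u,v)$ removes $e,u,v$, adds the vertex $u\cup v$, makes every other edge incident to $u$ or $v$ incident to $u\cup v$, and merges parallel edges into one edge, coloured red if at least one of the merged edges is red and green otherwise. Search tree of $G$: the root is $G$ with vertices regarded as singletons and all edges green. The children of a node with green edges $e_1,\dots,e_k$ (listed in some arbitrary order) are, for $1\le i\le k$, the contraction of $e_i$ in the graph obtained from the node by recolouring $e_1,\dots,e_{i-1}$ red. Each feasible coalition structure is represented by exactly one node of this tree, so feasible coalition structures are identified with nodes; $ST(CS_i)$ is the set of coalition structures represented by $CS_i$ and its descendants. $\overline{CS_i}$: if $CS_i$ is represented by the node $G_c$ of the tree, $\overline{CS_i}$ is the coalition structure obtained by removing all red edges from $G_c$ and then contracting all remaining green edges; i.e. its coalitions are the unions of the vertices of each connected component of $G_c$ after deletion of all red edges. *)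

theory Defs
  imports Complex_Main "HOL-Library.Disjoint_Sets"
begin

definition simple_graph :: "'v set \<Rightarrow> 'v set set \<Rightarrow> bool" where
  "simple_graph W F \<longleftrightarrow> finite W \<and> (\<forall>e\<in>F. e \<subseteq> W \<and> card e = 2)"

definition edge_rel :: "'v set set \<Rightarrow> ('v \<times> 'v) set" where
  "edge_rel F = {(x, y). {x, y} \<in> F}"

definition graph_connected :: "'v set \<Rightarrow> 'v set set \<Rightarrow> bool" where
  "graph_connected W F \<longleftrightarrow> (\<forall>x\<in>W. \<forall>y\<in>W. (x, y) \<in> (edge_rel F)\<^sup>*)"

definition graph_components :: "'v set \<Rightarrow> 'v set set \<Rightarrow> 'v set set" where
  "graph_components W F = (\<lambda>x. {y \<in> W. (x, y) \<in> (edge_rel F)\<^sup>*}) ` W"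

definition induced_edges :: "'v set set \<Rightarrow> 'v set \<Rightarrow> 'v set set" where
  "induced_edges F C = {e \<in> F. e \<subseteq> C}"

definition feasible_coalitions :: "'a set \<Rightarrow> 'a set set \<Rightarrow> 'a set set" where
  "feasible_coalitions A E =
     {C. C \<noteq> {} \<and> C \<subseteq> A \<and> graph_connected C (induced_edges E C)}"

definition coalition_structures :: "'a set \<Rightarrow> 'a set set \<Rightarrow> 'a set set set" where
  "coalition_structures A E = {P. partition_on A P \<and> P \<subseteq> feasible_coalitions A E}"

definition superadditive :: "'a set \<Rightarrow> 'a set set \<Rightarrow> ('a set \<Rightarrow> real) \<Rightarrow> bool" where
  "superadditive A E v \<longleftrightarrow>
     (\<forall>S\<in>feasible_coalitions A E. \<forall>T\<in>feasible_coalitions A E.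
        S \<inter> T = {} \<longrightarrow> S \<union> T \<in> feasible_coalitions A E \<longrightarrow> v (S \<union> T) \<ge> v S + v T)"

definition subadditive :: "'a set \<Rightarrow> 'a set set \<Rightarrow> ('a set \<Rightarrow> real) \<Rightarrow> bool" where
  "subadditive A E v \<longleftrightarrow>
     (\<forall>S\<in>feasible_coalitions A E. \<forall>T\<in>feasible_coalitions A E.
        S \<inter> T = {} \<longrightarrow> S \<union> T \<in> feasible_coalitions A E \<longrightarrow> v (S \<union> T) \<le> v S + v T)"

definition superadditive_cs ::
  "'a set \<Rightarrow> 'a set set \<Rightarrow> ('a set set \<Rightarrow> real) \<Rightarrow> bool" where
  "superadditive_cs A E V \<longleftrightarrow>
     (\<exists>v. superadditive A E v \<and> (\<forall>P\<in>coalition_structures A E. V P = (\<Sum>C\<in>P. v C)))"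

definition subadditive_cs ::
  "'a set \<Rightarrow> 'a set set \<Rightarrow> ('a set set \<Rightarrow> real) \<Rightarrow> bool" where
  "subadditive_cs A E V \<longleftrightarrow>
     (\<exists>v. subadditive A E v \<and> (\<forall>P\<in>coalition_structures A E. V P = (\<Sum>C\<in>P. v C)))"

text \<open>\<open>V\<close> is an m+a function, as witnessed by \<open>Vp\<close> and \<open>Vm\<close>; functions on coalitions and
  on coalition structures are unconstrained outside the feasible ones.\<close>

definition mpa_decomposition ::
  "'a set \<Rightarrow> 'a set set \<Rightarrow> ('a set set \<Rightarrow> real) \<Rightarrow> ('a set set \<Rightarrow> real)
     \<Rightarrow> ('a set set \<Rightarrow> real) \<Rightarrow> bool" where
  "mpa_decomposition A E V Vp Vm \<longleftrightarrow>
     superadditive_cs A E Vp \<and> subadditive_cs A E Vm \<and>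
     (\<forall>P\<in>coalition_structures A E. V P = Vp P + Vm P)"

datatype colour = Red | Green

text \<open>The vertices are coalitions, the edges two-element sets of coalitions. Only the
  colours of elements of \<open>edges\<close> are meaningful; the operations below keep the colouring
  constantly \<open>Green\<close> elsewhere, so that graphs with the same vertices, edges and edge
  colours are equal.\<close>

record 'a cgraph =
  verts :: "'a set set"
  edges :: "'a set set set"
  colour_of :: "'a set set \<Rightarrow> colour"

definition green_edges :: "'a cgraph \<Rightarrow> 'a set set set" where
  "green_edges g = {e \<in> edges g. colour_of g e = Green}"

definition merge_into :: "'a set set \<Rightarrow> 'a set \<Rightarrow> 'a set" where
  "merge_into e x = (if x \<in> e then \<Union>e else x)"

definition contract :: "'a set set \<Rightarrow> 'a cgraph \<Rightarrow> 'a cgraph" where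
  "contract e g =
     \<lparr>verts = insert (\<Union>e) (verts g - e),
      edges = (\<lambda>f. merge_into e ` f) ` (edges g - {e}),
      colour_of = (\<lambda>f. if \<exists>f'\<in>edges g - {e}. merge_into e ` f' = f \<and> colour_of g f' = Red
                       then Red else Green)\<rparr>"

definition recolour_red :: "'a set set set \<Rightarrow> 'a cgraph \<Rightarrow> 'a cgraph" where
  "recolour_red R g = g\<lparr>colour_of := (\<lambda>f. if f \<in> R then Red else colour_of g f)\<rparr>"

definition root_graph :: "'a set \<Rightarrow> 'a set set \<Rightarrow> 'a cgraph" where
  "root_graph A E =
     \<lparr>verts = (\<lambda>a. {a}) ` A,
      edges = (\<lambda>e. (\<lambda>a. {a}) ` e) ` E,
      colour_of = (\<lambda>_. Green)\<rparr>"

text \<open>\<open>ord g\<close> is the list in which the green edges of the node \<open>g\<close> are enumerated (from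
  index 0). A node is identified with its 2-coloured graph; since distinct nodes represent
  distinct coalition structures, an order that is a function of the graph still permits an
  independent choice at each node.\<close>

definition child_rel ::
  "('a cgraph \<Rightarrow> 'a set set list) \<Rightarrow> ('a cgraph \<times> 'a cgraph) set" where
  "child_rel ord =
     {(g, contract (ord g ! i) (recolour_red (set (take i (ord g))) g)) | g i.
        i < length (ord g)}"

definition descendants ::
  "('a cgraph \<Rightarrow> 'a set set list) \<Rightarrow> 'a cgraph \<Rightarrow> 'a cgraph set" where
  "descendants ord g = (child_rel ord)\<^sup>* `` {g}"

definition tree_nodes ::
  "'a set \<Rightarrow> 'a set set \<Rightarrow> ('a cgraph \<Rightarrow> 'a set set list) \<Rightarrow> 'a cgraph set" where
  "tree_nodes A E ord = descendants ord (root_graph A E)"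

definition green_edge_order ::
  "'a set \<Rightarrow> 'a set set \<Rightarrow> ('a cgraph \<Rightarrow> 'a set set list) \<Rightarrow> bool" where
  "green_edge_order A E ord \<longleftrightarrow>
     (\<forall>g\<in>tree_nodes A E ord. distinct (ord g) \<and> set (ord g) = green_edges g)"

text \<open>The node representing a feasible coalition structure. The definite description is
  justified because every feasible coalition structure is represented by exactly one node
  (given \<open>simple_graph A E\<close> and \<open>green_edge_order A E ord\<close>).\<close>

definition node_of ::
  "'a set \<Rightarrow> 'a set set \<Rightarrow> ('a cgraph \<Rightarrow> 'a set set list) \<Rightarrow> 'a set set \<Rightarrow> 'a cgraph" where
  "node_of A E ord P = (THE g. g \<in> tree_nodes A E ord \<and> verts g = P)"

definition ST ::
  "'a set \<Rightarrow> 'a set set \<Rightarrow> ('a cgraph \<Rightarrow> 'a set set list) \<Rightarrow> 'a set set \<Rightarrow> 'a set set set" where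
  "ST A E ord P = verts ` descendants ord (node_of A E ord P)"

definition cs_closure ::
  "'a set \<Rightarrow> 'a set set \<Rightarrow> ('a cgraph \<Rightarrow> 'a set set list) \<Rightarrow> 'a set set \<Rightarrow> 'a set set" where
  "cs_closure A E ord P =
     (let g = node_of A E ord P in Union ` graph_components (verts g) (green_edges g))"

definition M_bound ::
  "'a set \<Rightarrow> 'a set set \<Rightarrow> ('a cgraph \<Rightarrow> 'a set set list)
     \<Rightarrow> ('a set set \<Rightarrow> real) \<Rightarrow> ('a set set \<Rightarrow> real) \<Rightarrow> 'a set set \<Rightarrow> real" where
  "M_bound A E ord Vp Vm P = Vm P + Vp (cs_closure A E ord P)"

end

theory Submission imports Defs begin

text \<open>Call a coalition structure compatible with a node if it coarsens the vertices of the node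
  and no block contains a red edge. If it is not the node's own vertex set, then exactly one child
  is compatible with it, so the path from the root to it is forced; hence each feasible coalition
  structure is represented by exactly one node, and the descendants of a node are compatible with
  it. The blocks of such a descendant are connected by green edges, so the descendant lies between
  the vertex set of the node and its closure in the refinement order. Merging adjacent blocks one
  pair at a time shows that \<open>V\<^sup>-\<close> decreases and \<open>V\<^sup>+\<close> increases along this order.\<close>

section \<open>Quotient graphs and compatibility with a node\<close>

definition adjacent :: "'a set set \<Rightarrow> 'a set \<Rightarrow> 'a set \<Rightarrow> bool" where
  "adjacent E C D \<longleftrightarrow> (\<exists>x\<in>C. \<exists>y\<in>D. {x, y} \<in> E)"

text \<open>This is the graph left after contracting every block of \<open>P\<close> to a vertex.
  Edges are sets, so parallel edges are already merged, and \<open>C \<noteq> D\<close> excludes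
  loops.\<close>

definition quotient_edges :: "'a set set \<Rightarrow> 'a set set \<Rightarrow> 'a set set set" where
  "quotient_edges E P = {{C, D} | C D. C \<in> P \<and> D \<in> P \<and> C \<noteq> D \<and> adjacent E C D}"

text \<open>Colours are left out: the uncoloured graph of a node depends only on its partition,
  whereas the colours depend on the chosen order and enter through
  \<open>compatible\<close>.\<close>

definition well_formed_node :: "'a set \<Rightarrow> 'a set set \<Rightarrow> 'a cgraph \<Rightarrow> bool" where
  "well_formed_node A E g \<longleftrightarrow>
     verts g \<in> coalition_structures A E \<and> edges g = quotient_edges E (verts g)"

definition compatible :: "'a cgraph \<Rightarrow> 'a set set \<Rightarrow> bool" where
  "compatible g P \<longleftrightarrow>
     (\<forall>C\<in>verts g. \<exists>B\<in>P. C \<subseteq> B) \<and>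
     (\<forall>f\<in>edges g. colour_of g f = Red \<longrightarrow> \<not> (\<exists>B\<in>P. \<Union>f \<subseteq> B))"

lemma compatible_block: "compatible g Q \<Longrightarrow> C \<in> verts g \<Longrightarrow> \<exists>B\<in>Q. C \<subseteq> B"
  unfolding compatible_def by simp

lemma compatible_not_red:
  "compatible g Q \<Longrightarrow> f \<in> edges g \<Longrightarrow> B \<in> Q \<Longrightarrow> \<Union>f \<subseteq> B \<Longrightarrow> colour_of g f \<noteq> Red"
  unfolding compatible_def by auto

lemma adjacent_sym: "adjacent E C D \<Longrightarrow> adjacent E D C"
  unfolding adjacent_def by (metis insert_commute)

lemma adjacent_mono: "adjacent E C D \<Longrightarrow> C \<subseteq> C' \<Longrightarrow> D \<subseteq> D' \<Longrightarrow> adjacent E C' D'"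
  unfolding adjacent_def by blast

section \<open>Connectivity of unions of coalitions\<close>

lemma sym_edge_rel: "sym (edge_rel F)"
  by (auto simp: sym_def edge_rel_def insert_commute)

lemma rtrancl_edge_rel_sym: "(x, y) \<in> (edge_rel F)\<^sup>* \<Longrightarrow> (y, x) \<in> (edge_rel F)\<^sup>*"
  by (meson sym_edge_rel sym_rtrancl symD)

lemma rtrancl_edge_rel_induced_mono:
  assumes "(x, y) \<in> (edge_rel (induced_edges E C))\<^sup>*" "C \<subseteq> D"
  shows "(x, y) \<in> (edge_rel (induced_edges E D))\<^sup>*"
proof -
  have "edge_rel (induced_edges E C) \<subseteq> edge_rel (induced_edges E D)"
    using assms(2) by (auto simp: edge_rel_def induced_edges_def)
  then show ?thesis using assms(1) rtrancl_mono by blast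
qed

lemma rtrancl_leaves_set:
  assumes "(x, y) \<in> R\<^sup>*" "x \<in> S" "y \<notin> S"
  obtains u w where "(u, w) \<in> R" "u \<in> S" "w \<notin> S"
  using assms by (induction rule: rtrancl_induct) auto

text \<open>Each member is connected internally, and each step of the chain supplies an edge of
  \<open>E\<close> to the next member. The relation is restricted to \<open>K\<close> so that chains
  stay inside the union. It serves both for a pair of adjacent coalitions and for a component of
  green edges.\<close>

lemma feasible_Union:
  assumes K: "K \<subseteq> feasible_coalitions A E" and X: "X \<in> K"
    and reach: "\<And>C. C \<in> K \<Longrightarrow> (X, C) \<in> {(C, D). C \<in> K \<and> D \<in> K \<and> adjacent E C D}\<^sup>*"
  shows "\<Union>K \<in> feasible_coalitions A E"
proof -
  let ?S = "(edge_rel (induced_edges E (\<Union>K)))\<^sup>*"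
  have inner: "(x, y) \<in> ?S" if "C \<in> K" "x \<in> C" "y \<in> C" for C x y
  proof -
    have "(x, y) \<in> (edge_rel (induced_edges E C))\<^sup>*"
      using that K unfolding feasible_coalitions_def graph_connected_def by blast
    then show ?thesis by (rule rtrancl_edge_rel_induced_mono) (use that in blast)
  qed
  obtain x0 where x0: "x0 \<in> X" using X K unfolding feasible_coalitions_def by blast
  have from_x0: "\<forall>c\<in>C. (x0, c) \<in> ?S" if "C \<in> K" for C
    using reach[OF that]
  proof (induction rule: rtrancl_induct)
    case base
    show ?case using inner[OF X x0] by blast
  next
    case (step C D)
    then obtain c d where cd: "c \<in> C" "d \<in> D" "{c, d} \<in> E" "C \<in> K" "D \<in> K"
      unfolding adjacent_def by blast
    then have "(c, d) \<in> edge_rel (induced_edges E (\<Union>K))"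
      unfolding edge_rel_def induced_edges_def by blast
    then have "(x0, d) \<in> ?S" using step.IH cd(1) by (meson rtrancl.rtrancl_into_rtrancl)
    then show ?case using inner[OF cd(5,2)] by (meson rtrancl_trans)
  qed
  have "graph_connected (\<Union>K) (induced_edges E (\<Union>K))"
    unfolding graph_connected_def
    using from_x0 by (meson UnionE rtrancl_edge_rel_sym rtrancl_trans)
  then show ?thesis
    using K x0 X unfolding feasible_coalitions_def by blast
qed

lemma feasible_Un:
  assumes "C \<in> feasible_coalitions A E" "D \<in> feasible_coalitions A E" "adjacent E C D"
  shows "C \<union> D \<in> feasible_coalitions A E"
proof -
  have "\<Union>{C, D} \<in> feasible_coalitions A E"
  proof (rule feasible_Union[of _ _ _ C])
    fix X assume "X \<in> {C, D}"
    then show "(C, X) \<in> {(Y, Z). Y \<in> {C, D} \<and> Z \<in> {C, D} \<and> adjacent E Y Z}\<^sup>*"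
      using assms(3) by (cases "X = C") auto
  qed (use assms in auto)
  then show ?thesis by simp
qed

section \<open>Merging two adjacent blocks of a coalition structure\<close>

lemma block_eqI:
  assumes "partition_on A P" "B \<in> P" "B' \<in> P" "x \<in> B" "x \<in> B'"
  shows "B = B'"
  using assms unfolding partition_on_def disjoint_def by blast

lemma coalition_structuresD:
  assumes "P \<in> coalition_structures A E"
  shows "partition_on A P" "P \<subseteq> feasible_coalitions A E" "\<Union>P = A" "{} \<notin> P"
  using assms unfolding coalition_structures_def partition_on_def by auto

lemma merge_coalition_structure:
  assumes P: "P \<in> coalition_structures A E"
    and CD: "C \<in> P" "D \<in> P" "C \<noteq> D" "adjacent E C D"
  shows "insert (C \<union> D) (P - {C, D}) \<in> coalition_structures A E"
proof -
  note P' = coalition_structuresD[OF P]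
  have "disjoint P" using P'(1) by (rule partition_onD2)
  then have disj: "X \<inter> (C \<union> D) = {}" if "X \<in> P - {C, D}" for X
    using disjointD[of P X C] disjointD[of P X D] that CD by auto
  have "partition_on A (insert (C \<union> D) (P - {C, D}))"
  proof (rule partition_onI)
    show "\<Union>(insert (C \<union> D) (P - {C, D})) = A" using CD P'(3) by auto
    show "{} \<notin> insert (C \<union> D) (P - {C, D})" using CD P'(4) by auto
    show "disjnt X Y" if "X \<in> insert (C \<union> D) (P - {C, D})" "Y \<in> insert (C \<union> D) (P - {C, D})"
      "X \<noteq> Y" for X Y
      using that disj[of X] disj[of Y] disjointD[OF \<open>disjoint P\<close>, of X Y]
      unfolding disjnt_def by (elim insertE) (simp_all add: Int_commute)
  qed
  moreover have "C \<union> D \<in> feasible_coalitions A E"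
    using CD coalition_structuresD(2)[OF P] by (intro feasible_Un) auto
  ultimately show ?thesis
    using coalition_structuresD(2)[OF P] unfolding coalition_structures_def by blast
qed

text \<open>The union shares a point with each of the two blocks, so as a block it would equal both.
  Its newness lets sums over the merged structure split and keeps \<open>merge_into\<close> from
  identifying further vertices.\<close>

lemma merged_not_block:
  assumes "P \<in> coalition_structures A E" "C \<in> P" "D \<in> P" "C \<noteq> D"
  shows "C \<union> D \<notin> P"
proof
  note P = coalition_structuresD[OF assms(1)]
  assume U: "C \<union> D \<in> P"
  obtain x y where "x \<in> C" "y \<in> D" using assms(2,3) P(4) by (metis equals0I)
  then have "C = C \<union> D" "D = C \<union> D"
    using block_eqI[OF P(1) assms(2) U] block_eqI[OF P(1) assms(3) U] by auto
  then show False using assms(4) by simp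
qed

lemma finite_coalition_structures:
  assumes "finite A"
  shows "finite (coalition_structures A E)"
proof -
  have "coalition_structures A E \<subseteq> Pow (Pow A)"
    unfolding coalition_structures_def feasible_coalitions_def by blast
  then show ?thesis using assms by (meson finite_Pow_iff finite_subset)
qed

lemma finite_coalition_structure:
  assumes "finite A" "P \<in> coalition_structures A E"
  shows "finite P"
  using finite_elements[OF assms(1) coalition_structuresD(1)[OF assms(2)]] .

lemma card_merge:
  assumes "finite A" "P \<in> coalition_structures A E" "C \<in> P" "D \<in> P" "C \<noteq> D"
  shows "card (insert (C \<union> D) (P - {C, D})) < card P"
proof -
  have f: "finite P" using assms finite_coalition_structure by blast
  \<comment> \<open>This ensures that \<open>card P - 2\<close>, the size of the remainder, is not
    truncated at zero.\<close>
  have "card {C, D} \<le> card P" using assms f by (intro card_mono) auto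
  then have "Suc (card (P - {C, D})) < card P" using assms f by (simp add: card_Diff_subset)
  then show ?thesis using card_insert_if f by (metis Suc_lessD finite_Diff)
qed

text \<open>Some edge of the connected block \<open>B\<close> has to leave a proper sub-block of \<open>B\<close>.\<close>

lemma adjacent_blocks_of_refinement:
  assumes P: "P \<in> coalition_structures A E" and Q: "Q \<in> coalition_structures A E"
    and ref: "\<forall>C\<in>P. \<exists>B\<in>Q. C \<subseteq> B" and ne: "P \<noteq> Q"
  obtains C D B where "C \<in> P" "D \<in> P" "B \<in> Q" "C \<noteq> D" "adjacent E C D" "C \<union> D \<subseteq> B"
proof -
  have "\<exists>C\<in>P. C \<notin> Q"
  proof (rule ccontr)
    assume "\<not> ?thesis"
    then have sub: "P \<subseteq> Q" by blast
    have "B \<in> P" if B: "B \<in> Q" for B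
    proof -
      obtain x where "x \<in> B" using B coalition_structuresD(4)[OF Q] by fastforce
      then obtain C where "C \<in> P" "x \<in> C"
        using B coalition_structuresD(3)[OF Q] coalition_structuresD(3)[OF P] by blast
      then show ?thesis
        using block_eqI[OF coalition_structuresD(1)[OF Q] B] sub \<open>x \<in> B\<close> by blast
    qed
    then show False using ne sub by blast
  qed
  then obtain C B where C: "C \<in> P" "B \<in> Q" "C \<subseteq> B" "C \<noteq> B" using ref by blast
  obtain x y where x: "x \<in> C" and y: "y \<in> B" "y \<notin> C"
    using C coalition_structuresD(4)[OF P] by fastforce
  have "(x, y) \<in> (edge_rel (induced_edges E B))\<^sup>*"
    using x y C coalition_structuresD(2)[OF Q]
    unfolding feasible_coalitions_def graph_connected_def by blast
  then obtain u w where uw: "(u, w) \<in> edge_rel (induced_edges E B)" "u \<in> C" "w \<notin> C"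
    using rtrancl_leaves_set[of x y _ C] x y(2) by blast
  then have e: "{u, w} \<in> E" "w \<in> B" unfolding edge_rel_def induced_edges_def by auto
  obtain D where D: "D \<in> P" "w \<in> D"
    using e C coalition_structuresD(3)[OF Q] coalition_structuresD(3)[OF P] by blast
  then have "D \<subseteq> B"
    using ref block_eqI[OF coalition_structuresD(1)[OF Q] C(2)] e by blast
  moreover have "adjacent E C D" using uw e D unfolding adjacent_def by blast
  ultimately show ?thesis using that C D uw by blast
qed

section \<open>Monotonicity of sums under refinement\<close>

text \<open>As long as \<open>P\<close> differs from \<open>Q\<close>, two adjacent blocks of
  \<open>P\<close> lie in one block of \<open>Q\<close>. Merging them keeps feasibility and
  refinement, does not lower the sum, and reduces the number of blocks, on which the induction
  runs.\<close>

lemma superadditive_refinement: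
  assumes A: "finite A" and v: "superadditive A E v"
    and Q: "Q \<in> coalition_structures A E"
  shows "P \<in> coalition_structures A E \<Longrightarrow> \<forall>C\<in>P. \<exists>B\<in>Q. C \<subseteq> B \<Longrightarrow> sum v P \<le> sum v Q"
proof (induction "card P" arbitrary: P rule: less_induct)
  case less
  show ?case
  proof (cases "P = Q")
    case False
    then obtain C D B where CD: "C \<in> P" "D \<in> P" "B \<in> Q" "C \<noteq> D" "adjacent E C D" "C \<union> D \<subseteq> B"
      using adjacent_blocks_of_refinement less.prems Q by metis
    let ?P = "insert (C \<union> D) (P - {C, D})"
    have fin: "finite P" using finite_coalition_structure[OF A less.prems(1)] .
    have P': "?P \<in> coalition_structures A E"
      using merge_coalition_structure less.prems(1) CD by blast
    have "sum v ?P \<le> sum v Q"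
    proof (rule less.hyps[OF _ P'])
      show "card ?P < card P" using card_merge[OF A less.prems(1)] CD by blast
    qed (use CD less.prems in auto)
    moreover have "C \<inter> D = {}"
      using coalition_structuresD(1)[OF less.prems(1)] CD
      unfolding partition_on_def disjoint_def by blast
    then have "v C + v D \<le> v (C \<union> D)"
      using v CD coalition_structuresD(2)[OF less.prems(1)] coalition_structuresD(2)[OF P']
      unfolding superadditive_def by blast
    moreover have "sum v P = v C + v D + sum v (P - {C, D})"
      using sum.subset_diff[of "{C, D}" P v] CD fin by simp
    moreover have "sum v ?P = v (C \<union> D) + sum v (P - {C, D})"
      using fin merged_not_block[OF less.prems(1) CD(1,2,4)] by simp
    ultimately show ?thesis by linarith
  qed simp
qed

text \<open>Negation turns \<open>v\<close> into a superadditive function and reverses the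
  inequality.\<close>

lemma subadditive_refinement:
  assumes A: "finite A" and v: "subadditive A E v"
    and "P \<in> coalition_structures A E" "Q \<in> coalition_structures A E" "\<forall>C\<in>P. \<exists>B\<in>Q. C \<subseteq> B"
  shows "sum v Q \<le> sum v P"
proof -
  have "superadditive A E (\<lambda>C. - v C)"
    using v unfolding superadditive_def subadditive_def by fastforce
  then show ?thesis
    using superadditive_refinement[OF A, of E "\<lambda>C. - v C"] assms by (simp add: sum_negf)
qed

section \<open>Contraction as merging in the quotient graph\<close>

lemma quotient_edgesI:
  "C \<in> P \<Longrightarrow> D \<in> P \<Longrightarrow> C \<noteq> D \<Longrightarrow> adjacent E C D \<Longrightarrow> {C, D} \<in> quotient_edges E P"
  unfolding quotient_edges_def by blast

lemma quotient_edgesE: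
  assumes "f \<in> quotient_edges E P"
  obtains C D where "f = {C, D}" "C \<in> P" "D \<in> P" "C \<noteq> D" "adjacent E C D"
  using assms unfolding quotient_edges_def by blast

text \<open>Contracting and forming the quotient commute: \<open>C \<union> D\<close> is adjacent to
  exactly those other blocks that are adjacent to \<open>C\<close> or to \<open>D\<close>, and edges
  away from \<open>C\<close> and \<open>D\<close> do not change.\<close>

lemma quotient_edges_contract:
  assumes P: "P \<in> coalition_structures A E"
    and CD: "C \<in> P" "D \<in> P" "C \<noteq> D"
  shows "(\<lambda>f. merge_into {C, D} ` f) ` (quotient_edges E P - {{C, D}})
    = quotient_edges E (insert (C \<union> D) (P - {C, D}))" (is "?L = ?R")
proof
  have sub: "X \<subseteq> merge_into {C, D} X" for X by (auto simp: merge_into_def)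
  have new: "C \<union> D \<notin> P" using merged_not_block[OF P CD] .
  show "?L \<subseteq> ?R"
  proof
    fix h assume "h \<in> ?L"
    then obtain f where f: "f \<in> quotient_edges E P" "f \<noteq> {C, D}" "h = merge_into {C, D} ` f"
      by blast
    then obtain X Y where XY: "f = {X, Y}" "X \<in> P" "Y \<in> P" "X \<noteq> Y" "adjacent E X Y"
      using quotient_edgesE by metis
    \<comment> \<open>Only \<open>{C, D}\<close> itself collapses: if just one end of
      \<open>f\<close> is merged, the images differ because \<open>C \<union> D\<close> is not an
      old vertex.\<close>
    have "merge_into {C, D} X \<noteq> merge_into {C, D} Y"
      using XY new f(2) by (auto simp: merge_into_def split: if_splits)
    moreover have "adjacent E (merge_into {C, D} X) (merge_into {C, D} Y)"
      using XY(5) sub adjacent_mono by metis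
    moreover have "merge_into {C, D} Z \<in> insert (C \<union> D) (P - {C, D})" if "Z \<in> P" for Z
      using that by (auto simp: merge_into_def)
    ultimately have "{merge_into {C, D} X, merge_into {C, D} Y} \<in> ?R"
      using XY(2,3) quotient_edgesI by metis
    then show "h \<in> ?R" using f(3) XY(1) by simp
  qed
  have merged: "{C \<union> D, Y} \<in> ?L" if Y: "Y \<in> P - {C, D}" and adj: "adjacent E (C \<union> D) Y" for Y
  proof -
    obtain Z where Z: "Z \<in> {C, D}" "adjacent E Z Y"
      using adj unfolding adjacent_def by blast
    have "{Z, Y} \<in> quotient_edges E P - {{C, D}}"
      using Y Z CD unfolding quotient_edges_def by auto
    moreover have "merge_into {C, D} ` {Z, Y} = {C \<union> D, Y}"
      using Y Z by (auto simp: merge_into_def)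
    ultimately show ?thesis by (metis image_eqI)
  qed
  show "?R \<subseteq> ?L"
  proof
    fix h assume "h \<in> ?R"
    then obtain X Y where XY: "h = {X, Y}" "X \<in> insert (C \<union> D) (P - {C, D})"
      "Y \<in> insert (C \<union> D) (P - {C, D})" "X \<noteq> Y" "adjacent E X Y"
      using quotient_edgesE by metis
    consider "X = C \<union> D" "Y \<in> P - {C, D}" | "Y = C \<union> D" "X \<in> P - {C, D}"
      | "X \<in> P - {C, D}" "Y \<in> P - {C, D}" using XY(2-4) by (elim insertE) auto
    then show "h \<in> ?L"
    proof cases
      case 1
      then show ?thesis using merged[of Y] XY(1,5) by simp
    next
      case 2
      then show ?thesis using merged[of X] XY(1) adjacent_sym[OF XY(5)] by (simp add: insert_commute)
    next
      case 3
      then have "{X, Y} \<in> quotient_edges E P - {{C, D}}"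
        using XY(4,5) quotient_edgesI[of X P Y E] by auto
      moreover have "merge_into {C, D} ` {X, Y} = h"
        using 3 XY(1) by (auto simp: merge_into_def)
      ultimately show ?thesis by (metis image_eqI)
    qed
  qed
qed

lemma well_formed_node_edgeE:
  assumes "well_formed_node A E g" "e \<in> edges g"
  obtains C D where "e = {C, D}" "C \<in> verts g" "D \<in> verts g" "C \<noteq> D" "adjacent E C D"
  using assms quotient_edgesE unfolding well_formed_node_def by metis

lemma verts_contract_recolour [simp]:
  "verts (contract e (recolour_red R g)) = insert (\<Union>e) (verts g - e)"
  by (simp add: contract_def recolour_red_def)

text \<open>The set \<open>R\<close> is arbitrary, since recolouring changes neither vertices nor
  edges.\<close>

lemma well_formed_node_contract:
  assumes g: "well_formed_node A E g" and e: "e \<in> edges g"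
  shows "well_formed_node A E (contract e (recolour_red R g))"
proof -
  obtain C D where CD: "e = {C, D}" "C \<in> verts g" "D \<in> verts g" "C \<noteq> D" "adjacent E C D"
    using well_formed_node_edgeE[OF g e] .
  then show ?thesis
    using g quotient_edges_contract[of "verts g" A E C D] merge_coalition_structure[of "verts g" A E C D]
    unfolding well_formed_node_def by (simp add: contract_def recolour_red_def)
qed

text \<open>An edge of a simple graph has two distinct ends, so its image joins two distinct
  singletons.\<close>

lemma well_formed_root:
  assumes "simple_graph A E"
  shows "well_formed_node A E (root_graph A E)"
proof -
  have "(\<lambda>a. {a}) ` A \<in> coalition_structures A E"
    unfolding coalition_structures_def partition_on_def disjoint_def feasible_coalitions_def
      graph_connected_def by auto
  moreover have "(\<lambda>e. (\<lambda>a. {a}) ` e) ` E = quotient_edges E ((\<lambda>a. {a}) ` A)" (is "?L = ?R")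
  proof
    show "?L \<subseteq> ?R"
    proof
      fix h assume "h \<in> ?L"
      then obtain e where e: "e \<in> E" "h = (\<lambda>a. {a}) ` e" by blast
      then have "card e = 2" "e \<subseteq> A" using assms unfolding simple_graph_def by auto
      then obtain x y where "e = {x, y}" "x \<noteq> y" by (meson card_2_iff)
      then have "h = {{x}, {y}}" "{x} \<noteq> {y}" "adjacent E {x} {y}"
        "{x} \<in> (\<lambda>a. {a}) ` A" "{y} \<in> (\<lambda>a. {a}) ` A"
        using e \<open>e \<subseteq> A\<close> unfolding adjacent_def by auto
      then show "h \<in> ?R" unfolding quotient_edges_def by blast
    qed
    show "?R \<subseteq> ?L"
    proof
      fix h assume "h \<in> ?R"
      then obtain C D where "h = {C, D}" "C \<in> (\<lambda>a. {a}) ` A" "D \<in> (\<lambda>a. {a}) ` A" "adjacent E C D"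
        using quotient_edgesE by metis
      then obtain x y where "h = {{x}, {y}}" "{x, y} \<in> E" unfolding adjacent_def by blast
      then show "h \<in> ?L" by (intro image_eqI[of _ _ "{x, y}"]) auto
    qed
  qed
  ultimately show ?thesis unfolding well_formed_node_def root_graph_def by simp
qed

section \<open>Compatibility under contraction\<close>

text \<open>Compatibility passes from child to parent because a red edge survives as a red edge. If
  both its ends lay in a block \<open>B\<close>, so would its image, as the block holding the merged
  vertex would meet \<open>B\<close>.\<close>

lemma compatible_contractD:
  assumes g: "well_formed_node A E g" and e: "e \<in> green_edges g" and R: "e \<notin> R"
    and Q: "partition_on A Q"
    and comp: "compatible (contract e (recolour_red R g)) Q"
  shows "compatible g Q" "\<exists>B\<in>Q. \<Union>e \<subseteq> B"
    "\<And>f B. f \<in> R \<Longrightarrow> f \<in> edges g \<Longrightarrow> B \<in> Q \<Longrightarrow> \<not> \<Union>f \<subseteq> B"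
proof -
  let ?h = "contract e (recolour_red R g)"
  have ref: "\<forall>C\<in>insert (\<Union>e) (verts g - e). \<exists>B\<in>Q. C \<subseteq> B"
    using comp unfolding compatible_def by simp
  then show block: "\<exists>B\<in>Q. \<Union>e \<subseteq> B" by blast
  have red: "\<not> \<Union>f \<subseteq> B" if f: "f \<in> edges g" "f \<in> R \<or> colour_of g f = Red" "B \<in> Q" for f B
  proof
    assume fB: "\<Union>f \<subseteq> B"
    \<comment> \<open>The contracted edge is green and outside \<open>R\<close>, so every red edge
      has an image in the child.\<close>
    have "f \<noteq> e" using e R f(2) unfolding green_edges_def by auto
    then have f': "merge_into e ` f \<in> edges ?h" "colour_of ?h (merge_into e ` f) = Red"
      using f(1,2) by (auto simp: contract_def recolour_red_def)
    have "merge_into e X \<subseteq> B" if X: "X \<in> f" for X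
    proof (cases "X \<in> e")
      case True
      \<comment> \<open>The block holding \<open>\<Union>e\<close> shares the nonempty
        \<open>X\<close> with \<open>B\<close>, so the two blocks coincide.\<close>
      obtain B' where B': "B' \<in> Q" "\<Union>e \<subseteq> B'" using block by blast
      have "X \<in> verts g" using well_formed_node_edgeE[OF g f(1)] X by blast
      then obtain x where "x \<in> X"
        using g coalition_structuresD(4) unfolding well_formed_node_def by (metis equals0I)
      then have "B' = B" using block_eqI[OF Q B'(1) f(3), of x] B' True X fB by blast
      then show ?thesis using B' True by (simp add: merge_into_def)
    next
      case False
      then show ?thesis using fB X by (auto simp: merge_into_def)
    qed
    then have "\<Union>(merge_into e ` f) \<subseteq> B" by blast
    then show False using comp f' f(3) unfolding compatible_def by blast
  qed
  show "\<not> \<Union>f \<subseteq> B" if "f \<in> R" "f \<in> edges g" "B \<in> Q" for f B using red that by blast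
  have "\<exists>B\<in>Q. C \<subseteq> B" if "C \<in> verts g" for C using ref that block by (cases "C \<in> e") blast+
  then show "compatible g Q" using red unfolding compatible_def by blast
qed

text \<open>A red edge of the contraction comes from an edge that is red in \<open>g\<close> or
  belongs to \<open>R\<close>. Merging only enlarges vertices, so a block containing the image would
  contain the original edge too.\<close>

lemma compatible_contractI:
  assumes comp: "compatible g Q" and B: "B \<in> Q" "\<Union>e \<subseteq> B"
    and R: "\<And>f B. f \<in> R \<Longrightarrow> B \<in> Q \<Longrightarrow> \<not> \<Union>f \<subseteq> B"
  shows "compatible (contract e (recolour_red R g)) Q"
proof -
  let ?h = "contract e (recolour_red R g)"
  have "\<not> \<Union>h \<subseteq> B" if h: "h \<in> edges ?h" "colour_of ?h h = Red" "B \<in> Q" for h B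
  proof
    assume hB: "\<Union>h \<subseteq> B"
    obtain f where f: "f \<in> edges g" "merge_into e ` f = h" "f \<in> R \<or> colour_of g f = Red"
      using h(2) by (auto simp: contract_def recolour_red_def split: if_splits)
    have "X \<subseteq> merge_into e X" for X by (auto simp: merge_into_def)
    then have "\<Union>f \<subseteq> B" using f(2) hB by blast
    then show False using R f comp h(3) unfolding compatible_def by blast
  qed
  then show ?thesis using comp B unfolding compatible_def by auto
qed

text \<open>The ends of an edge are distinct blocks, so no vertex contains both, whatever the
  colour. This is the base case when compatibility is carried up a path of the tree.\<close>

lemma compatible_verts:
  assumes "well_formed_node A E g"
  shows "compatible g (verts g)"
proof -
  have P: "verts g \<in> coalition_structures A E" using assms unfolding well_formed_node_def ..
  have crossing: "\<not> \<Union>f \<subseteq> B" if f: "f \<in> edges g" and B: "B \<in> verts g" for f B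
  proof
    assume fB: "\<Union>f \<subseteq> B"
    obtain C D where CD: "f = {C, D}" "C \<in> verts g" "D \<in> verts g" "C \<noteq> D"
      using well_formed_node_edgeE[OF assms f] by metis
    have "X = B" if "X \<in> f" for X
    proof -
      have X: "X \<in> verts g" using that CD by blast
      then obtain x where "x \<in> X" using coalition_structuresD(4)[OF P] by (metis equals0I)
      then show ?thesis
        using block_eqI[OF coalition_structuresD(1)[OF P] X B] fB that by blast
    qed
    then have "C = B" "D = B" using CD(1) by simp_all
    then show False using CD(4) by simp
  qed
  show ?thesis unfolding compatible_def
  proof (intro conjI ballI impI notI)
    fix C assume "C \<in> verts g"
    then show "\<exists>B\<in>verts g. C \<subseteq> B" by (rule bexI[rotated]) simp
  next
    fix f assume "f \<in> edges g" "\<exists>B\<in>verts g. \<Union>f \<subseteq> B"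
    then show False using crossing by (elim bexE) simp
  qed
qed

text \<open>The root has singletons as vertices and no red edge.\<close>

lemma compatible_root:
  assumes "P \<in> coalition_structures A E"
  shows "compatible (root_graph A E) P"
proof -
  have "\<forall>a\<in>A. \<exists>B\<in>P. a \<in> B" using coalition_structuresD(3)[OF assms] by blast
  then show ?thesis unfolding compatible_def root_graph_def by simp
qed

text \<open>The edge set is that of the quotient graph, so a compatible coalition structure lying
  strictly above the node has a block containing an edge, and such an edge cannot be red.\<close>

lemma compatible_green_edge:
  assumes g: "well_formed_node A E g" and comp: "compatible g Q"
    and Q: "Q \<in> coalition_structures A E" "verts g \<noteq> Q"
  obtains e B where "e \<in> green_edges g" "B \<in> Q" "\<Union>e \<subseteq> B"
proof -
  obtain C D B where CD: "C \<in> verts g" "D \<in> verts g" "B \<in> Q" "C \<noteq> D" "adjacent E C D" "C \<union> D \<subseteq> B"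
  proof (rule adjacent_blocks_of_refinement[OF _ Q(1) _ Q(2)])
    show "verts g \<in> coalition_structures A E" using g unfolding well_formed_node_def ..
    show "\<forall>C\<in>verts g. \<exists>B\<in>Q. C \<subseteq> B" using compatible_block[OF comp] ..
  qed
  have e: "{C, D} \<in> edges g"
    using g quotient_edgesI[OF CD(1,2,4,5)] unfolding well_formed_node_def by simp
  moreover have "colour_of g {C, D} \<noteq> Red"
    using compatible_not_red[OF comp e CD(3)] CD(6) by simp
  then have "colour_of g {C, D} = Green" by (cases "colour_of g {C, D}") auto
  ultimately show ?thesis using that[of "{C, D}" B] CD unfolding green_edges_def by simp
qed

section \<open>The closure along green edges\<close>

text \<open>The construction of \<open>cs_closure\<close> with the node as argument, so that it can
  be studied for any well-formed node, free of the definite description.\<close>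

definition green_closure :: "'a cgraph \<Rightarrow> 'a set set" where
  "green_closure g = Union ` graph_components (verts g) (green_edges g)"

lemma green_edge_adjacent:
  assumes "well_formed_node A E g" "(C, D) \<in> edge_rel (green_edges g)"
  shows "C \<in> verts g" "D \<in> verts g" "adjacent E C D"
proof -
  have "{C, D} \<in> edges g" using assms(2) unfolding edge_rel_def green_edges_def by blast
  then obtain X Y where "{C, D} = {X, Y}" "X \<in> verts g" "Y \<in> verts g" "X \<noteq> Y" "adjacent E X Y"
    using well_formed_node_edgeE[OF assms(1)] by metis
  then show "C \<in> verts g" "D \<in> verts g" "adjacent E C D"
    using adjacent_sym by (auto simp: doubleton_eq_iff)
qed

text \<open>Green reachability is an equivalence on the vertices, so distinct classes have disjoint
  unions; each union is connected because green edges come from adjacency in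
  \<open>E\<close>.\<close>

lemma green_closure_coalition_structure:
  assumes g: "well_formed_node A E g"
  shows "green_closure g \<in> coalition_structures A E"
proof -
  let ?r = "(edge_rel (green_edges g))\<^sup>*"
  define K where "K X = {Y \<in> verts g. (X, Y) \<in> ?r}" for X
  have P: "verts g \<in> coalition_structures A E" using g unfolding well_formed_node_def ..
  note P' = coalition_structuresD[OF P]
  have cl: "green_closure g = (\<lambda>X. \<Union>(K X)) ` verts g"
    unfolding green_closure_def graph_components_def K_def by auto
  have self: "X \<in> K X" if "X \<in> verts g" for X using that unfolding K_def by simp
  have feas: "\<Union>(K X) \<in> feasible_coalitions A E" if X: "X \<in> verts g" for X
  proof (rule feasible_Union[OF _ self[OF X]])
    show "K X \<subseteq> feasible_coalitions A E" using P' unfolding K_def by blast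
    fix C assume "C \<in> K X"
    then have "(X, C) \<in> ?r" unfolding K_def by blast
    then show "(X, C) \<in> {(C, D). C \<in> K X \<and> D \<in> K X \<and> adjacent E C D}\<^sup>*"
    proof (induction rule: rtrancl_induct)
      case (step C D)
      have "(X, D) \<in> ?r" using step by (meson rtrancl.rtrancl_into_rtrancl)
      then have "C \<in> K X" "D \<in> K X" "adjacent E C D"
        using step green_edge_adjacent[OF g step.hyps(2)] unfolding K_def by auto
      then show ?case using step.IH by (auto intro: rtrancl.rtrancl_into_rtrancl)
    qed simp
  qed
  \<comment> \<open>A common point lies in a single vertex of \<open>g\<close>, which belongs to
    both components and forces them to coincide.\<close>
  have disj: "\<Union>(K X) = \<Union>(K Y)" if XY: "x \<in> \<Union>(K X)" "x \<in> \<Union>(K Y)" for X Y x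
  proof -
    obtain C D where CD: "x \<in> C" "x \<in> D" "C \<in> K X" "D \<in> K Y" using XY by blast
    then have "C = D" using block_eqI[OF P'(1)] unfolding K_def by blast
    then have "(X, C) \<in> ?r" "(Y, C) \<in> ?r" using CD unfolding K_def by auto
    then have "(X, Y) \<in> ?r" "(Y, X) \<in> ?r"
      by (meson rtrancl_edge_rel_sym rtrancl_trans)+
    then have "K X = K Y" unfolding K_def by (auto intro: rtrancl_trans)
    then show ?thesis by simp
  qed
  have "disjoint (green_closure g)"
    unfolding disjoint_def cl using disj by blast
  moreover have "\<Union>(green_closure g) = A"
  proof
    show "\<Union>(green_closure g) \<subseteq> A" using P'(3) unfolding cl K_def by blast
    show "A \<subseteq> \<Union>(green_closure g)" using P'(3) self unfolding cl by blast
  qed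
  moreover have "green_closure g \<subseteq> feasible_coalitions A E" using feas unfolding cl by blast
  moreover then have "{} \<notin> green_closure g" unfolding feasible_coalitions_def by blast
  ultimately show ?thesis unfolding coalition_structures_def partition_on_def by blast
qed

text \<open>A path inside the connected block \<open>B\<close> lifts to the node: each step stays in
  one vertex or crosses an edge whose ends both lie in \<open>B\<close>, and compatibility forbids
  that edge to be red. Hence all vertices meeting \<open>B\<close> lie in one green
  component.\<close>

lemma compatible_refines_green_closure:
  assumes g: "well_formed_node A E g" and Q: "Q \<in> coalition_structures A E"
    and comp: "compatible g Q" and B: "B \<in> Q"
  shows "\<exists>K\<in>green_closure g. B \<subseteq> K"
proof -
  let ?r = "(edge_rel (green_edges g))\<^sup>*"
  have P: "verts g \<in> coalition_structures A E" using g unfolding well_formed_node_def ..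
  note P' = coalition_structuresD[OF P] and Q' = coalition_structuresD[OF Q]
  obtain x where x: "x \<in> B" using B Q'(4) by fastforce
  obtain C where C: "C \<in> verts g" "x \<in> C" using x B P'(3) Q'(3) by blast
  \<comment> \<open>Covering every vertex through \<open>y\<close> makes the induction hypothesis
    apply to whichever vertex is picked for the previous point.\<close>
  have reach: "\<forall>D\<in>verts g. y \<in> D \<longrightarrow> (C, D) \<in> ?r"
    if "(x, y) \<in> (edge_rel (induced_edges E B))\<^sup>*" for y
    using that
  proof (induction rule: rtrancl_induct)
    case base
    have "D = C" if "D \<in> verts g" "x \<in> D" for D using block_eqI[OF P'(1)] that C by blast
    then show ?case by blast
  next
    case (step y z)
    have yz: "{y, z} \<in> E" "y \<in> B" "z \<in> B"
      using step.hyps unfolding edge_rel_def induced_edges_def by auto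
    obtain Y where Y: "Y \<in> verts g" "y \<in> Y" using yz B P'(3) Q'(3) by blast
    show ?case
    proof (intro ballI impI)
      fix Z assume Z: "Z \<in> verts g" "z \<in> Z"
      have CY: "(C, Y) \<in> ?r" using step.IH Y by blast
      show "(C, Z) \<in> ?r"
      proof (cases "Y = Z")
        case False
        have "adjacent E Y Z" using Y Z yz unfolding adjacent_def by blast
        with False have e: "{Y, Z} \<in> edges g"
          using g quotient_edgesI[OF Y(1) Z(1)] unfolding well_formed_node_def by simp
        \<comment> \<open>A vertex lies in some block of \<open>Q\<close>; when it meets
          \<open>B\<close>, that block can only be \<open>B\<close>.\<close>
        have "W \<subseteq> B" if W: "W \<in> verts g" "w \<in> W" "w \<in> B" for W w
        proof -
          obtain B' where "B' \<in> Q" "W \<subseteq> B'" using compatible_block[OF comp W(1)] by blast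
          then show ?thesis using block_eqI[OF Q'(1) B] W(2,3) by blast
        qed
        then have "\<Union>{Y, Z} \<subseteq> B" using Y Z yz by simp
        then have "colour_of g {Y, Z} \<noteq> Red" using compatible_not_red[OF comp e B] by blast
        then have "colour_of g {Y, Z} = Green" by (cases "colour_of g {Y, Z}") auto
        then have "(Y, Z) \<in> edge_rel (green_edges g)"
          using e unfolding edge_rel_def green_edges_def by simp
        then show ?thesis using CY by (meson rtrancl.rtrancl_into_rtrancl)
      qed (use CY in simp)
    qed
  qed
  have "B \<subseteq> \<Union>{Y \<in> verts g. (C, Y) \<in> ?r}"
  proof
    fix y assume y: "y \<in> B"
    have "(x, y) \<in> (edge_rel (induced_edges E B))\<^sup>*"
      using x y B Q'(2) unfolding feasible_coalitions_def graph_connected_def by blast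
    moreover obtain D where "D \<in> verts g" "y \<in> D" using y B P'(3) Q'(3) by blast
    ultimately show "y \<in> \<Union>{Y \<in> verts g. (C, Y) \<in> ?r}" using reach by blast
  qed
  then show ?thesis using C unfolding green_closure_def graph_components_def by blast
qed

section \<open>Nodes and children in the search tree\<close>

locale search_tree =
  fixes A :: "'a set" and E :: "'a set set" and ord :: "'a cgraph \<Rightarrow> 'a set set list"
  assumes simple: "simple_graph A E" and order: "green_edge_order A E ord"
begin

lemma finite_vertices: "finite A"
  using simple unfolding simple_graph_def by blast

lemma tree_nodes_child:
  assumes "g \<in> tree_nodes A E ord" "(g, h) \<in> child_rel ord"
  shows "h \<in> tree_nodes A E ord"
  using assms unfolding tree_nodes_def descendants_def Image_singleton_iff
  by (rule rtrancl.rtrancl_into_rtrancl)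

lemma set_ord: "g \<in> tree_nodes A E ord \<Longrightarrow> set (ord g) = green_edges g"
  and distinct_ord: "g \<in> tree_nodes A E ord \<Longrightarrow> distinct (ord g)"
  using order unfolding green_edge_order_def by simp_all

lemma childE:
  assumes "g \<in> tree_nodes A E ord" "(g, h) \<in> child_rel ord"
  obtains i where "i < length (ord g)" "ord g ! i \<in> green_edges g"
    "ord g ! i \<notin> set (take i (ord g))" "h = contract (ord g ! i) (recolour_red (set (take i (ord g))) g)"
proof -
  obtain i where i: "i < length (ord g)" "h = contract (ord g ! i) (recolour_red (set (take i (ord g))) g)"
    using assms(2) unfolding child_rel_def by blast
  moreover have "ord g ! i \<in> green_edges g" using i set_ord[OF assms(1)] by (metis nth_mem)
  \<comment> \<open>Without repetitions in the list, the edge at index \<open>i\<close> is not among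
    the first \<open>i\<close>, so it is still green when contracted.\<close>
  moreover have "ord g ! i \<notin> set (take i (ord g))"
    using i distinct_ord[OF assms(1)] by (auto simp: in_set_conv_nth nth_eq_iff_index_eq)
  ultimately show ?thesis using that by blast
qed

lemma tree_node_well_formed:
  assumes "g \<in> tree_nodes A E ord"
  shows "well_formed_node A E g"
proof -
  have "(root_graph A E, g) \<in> (child_rel ord)\<^sup>*"
    using assms unfolding tree_nodes_def descendants_def by blast
  then show ?thesis
  proof (induction rule: rtrancl_induct)
    case base
    show ?case using well_formed_root[OF simple] .
  next
    case (step g h)
    then have "g \<in> tree_nodes A E ord" unfolding tree_nodes_def descendants_def by blast
    then obtain i where "ord g ! i \<in> green_edges g"
      "h = contract (ord g ! i) (recolour_red (set (take i (ord g))) g)"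
      using childE step.hyps(2) by metis
    then show ?case using well_formed_node_contract[OF step.IH] unfolding green_edges_def by blast
  qed
qed

lemma tree_node_coalition_structure:
  "g \<in> tree_nodes A E ord \<Longrightarrow> verts g \<in> coalition_structures A E"
  using tree_node_well_formed unfolding well_formed_node_def by blast

text \<open>Each contraction merges two vertices. The strict decrease makes the descent towards a
  given structure terminate and separates a node from its proper descendants.\<close>

lemma card_child:
  assumes g: "g \<in> tree_nodes A E ord" and h: "(g, h) \<in> child_rel ord"
  shows "card (verts h) < card (verts g)"
proof -
  obtain i where i: "ord g ! i \<in> green_edges g"
    "h = contract (ord g ! i) (recolour_red (set (take i (ord g))) g)"
    using childE[OF g h] by metis
  then have "ord g ! i \<in> edges g" unfolding green_edges_def by blast
  then obtain C D where CD: "ord g ! i = {C, D}" "C \<in> verts g" "D \<in> verts g" "C \<noteq> D"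
    using well_formed_node_edgeE[OF tree_node_well_formed[OF g]] by metis
  then show ?thesis
    using i card_merge[OF finite_vertices tree_node_coalition_structure[OF g] CD(2-4)] by simp
qed

section \<open>Paths in the tree and the node of a coalition structure\<close>

text \<open>The vertices of \<open>h\<close> are compatible with \<open>h\<close> itself, and
  compatibility passes back from child to parent; hence the converse induction, which keeps
  \<open>h\<close> fixed.\<close>

lemma compatible_descendant:
  assumes "(g, h) \<in> (child_rel ord)\<^sup>*" "g \<in> tree_nodes A E ord"
  shows "h \<in> tree_nodes A E ord \<and> card (verts h) \<le> card (verts g) \<and> compatible g (verts h)"
  using assms
proof (induction rule: converse_rtrancl_induct)
  case base
  then show ?case using compatible_verts tree_node_well_formed by blast
next
  case (step g g')
  have h: "h \<in> tree_nodes A E ord" "card (verts h) \<le> card (verts g')" "compatible g' (verts h)"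
    using step tree_nodes_child by blast+
  obtain i where "ord g ! i \<in> green_edges g" "ord g ! i \<notin> set (take i (ord g))"
    "g' = contract (ord g ! i) (recolour_red (set (take i (ord g))) g)"
    using childE step by metis
  then have "compatible g (verts h)"
    using compatible_contractD(1)[OF tree_node_well_formed[OF step.prems]] h
      coalition_structuresD(1)[OF tree_node_coalition_structure[OF h(1)]] by blast
  then show ?case using h card_child[OF step.prems step.hyps(1)] by simp
qed

text \<open>The only compatible child contracts the first listed edge that lies inside a block:
  contracting an earlier edge leaves the coarsenings, a later one turns that edge red.\<close>

lemma compatible_child_unique:
  assumes g: "g \<in> tree_nodes A E ord" and Q: "partition_on A Q"
    and h: "(g, h) \<in> child_rel ord" "compatible h Q"
    and h': "(g, h') \<in> child_rel ord" "compatible h' Q"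
  shows "h = h'"
proof -
  obtain i where i: "i < length (ord g)" "ord g ! i \<in> green_edges g"
    "ord g ! i \<notin> set (take i (ord g))" "h = contract (ord g ! i) (recolour_red (set (take i (ord g))) g)"
    using childE[OF g h(1)] .
  obtain j where j: "j < length (ord g)" "ord g ! j \<in> green_edges g"
    "ord g ! j \<notin> set (take j (ord g))" "h' = contract (ord g ! j) (recolour_red (set (take j (ord g))) g)"
    using childE[OF g h'(1)] .
  note D = compatible_contractD(2,3)[OF tree_node_well_formed[OF g]]
  have gi: "ord g ! i \<in> edges g" and gj: "ord g ! j \<in> edges g"
    using i(2) j(2) unfolding green_edges_def by simp_all
  have "\<not> i < j"
  proof
    assume "i < j"
    then have "ord g ! i \<in> set (take j (ord g))" using j(1) by (auto simp: in_set_conv_nth)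
    then show False using D(1)[OF i(2,3) Q] D(2)[OF j(2,3) Q _ _ gi] h(2) h'(2) i(4) j(4) by metis
  qed
  moreover have "\<not> j < i"
  proof
    assume "j < i"
    then have "ord g ! j \<in> set (take i (ord g))" using i(1) by (auto simp: in_set_conv_nth)
    then show False using D(1)[OF j(2,3) Q] D(2)[OF i(2,3) Q _ _ gj] h(2) h'(2) i(4) j(4) by metis
  qed
  ultimately have "i = j" by simp
  then show ?thesis using i j by simp
qed

text \<open>The child to take contracts the first listed edge contained in a block of
  \<open>Q\<close>; by minimality no edge recoloured before it is contained in a block.\<close>

lemma compatible_child_exists:
  assumes g: "g \<in> tree_nodes A E ord" and Q: "Q \<in> coalition_structures A E"
    and comp: "compatible g Q" and ne: "verts g \<noteq> Q"
  obtains h where "(g, h) \<in> child_rel ord" "compatible h Q"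
proof -
  define inside where "inside i \<longleftrightarrow> i < length (ord g) \<and> (\<exists>B\<in>Q. \<Union>(ord g ! i) \<subseteq> B)" for i
  obtain e B where "e \<in> green_edges g" "B \<in> Q" "\<Union>e \<subseteq> B"
    using compatible_green_edge[OF tree_node_well_formed[OF g] comp Q ne] .
  then have "\<exists>i. inside i" using set_ord[OF g] unfolding inside_def by (metis in_set_conv_nth)
  then have i: "inside (LEAST i. inside i)" (is "inside ?i") by (rule LeastI_ex)
  then obtain B where B: "?i < length (ord g)" "B \<in> Q" "\<Union>(ord g ! ?i) \<subseteq> B"
    unfolding inside_def by blast
  have "compatible (contract (ord g ! ?i) (recolour_red (set (take ?i (ord g))) g)) Q"
  proof (rule compatible_contractI[OF comp B(2,3)])
    fix f B assume f: "f \<in> set (take ?i (ord g))" and "B \<in> Q"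
    then obtain k where "k < ?i" "f = ord g ! k" using B(1) by (auto simp: in_set_conv_nth)
    then show "\<not> \<Union>f \<subseteq> B"
      using not_less_Least[of k inside] B(1) \<open>B \<in> Q\<close> unfolding inside_def by auto
  qed
  then show ?thesis using that B(1) unfolding child_rel_def by blast
qed

text \<open>Repeated descent to a compatible child ends because the number of vertices falls, and it
  can only stop at \<open>Q\<close>.\<close>

lemma compatible_descendant_exists:
  assumes Q: "Q \<in> coalition_structures A E"
  shows "g \<in> tree_nodes A E ord \<Longrightarrow> compatible g Q \<Longrightarrow> \<exists>h\<in>tree_nodes A E ord. verts h = Q"
proof (induction "card (verts g)" arbitrary: g rule: less_induct)
  case less
  show ?case
  proof (cases "verts g = Q")
    case False
    then obtain h where "(g, h) \<in> child_rel ord" "compatible h Q"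
      using compatible_child_exists less.prems Q by metis
    then show ?thesis using less.hyps card_child tree_nodes_child less.prems(1) by blast
  qed (use less.prems in blast)
qed

text \<open>The common final vertex set is compatible with the first child on either path, so these
  children agree and the paths coincide step by step.\<close>

lemma descendant_unique:
  assumes "(g, h) \<in> (child_rel ord)\<^sup>*" "(g, h') \<in> (child_rel ord)\<^sup>*" "g \<in> tree_nodes A E ord"
    "verts h = verts h'"
  shows "h = h'"
  using assms
proof (induction rule: converse_rtrancl_induct)
  case base
  from base(1) show ?case
  proof (cases rule: converse_rtranclE)
    \<comment> \<open>A nonempty path from \<open>h\<close> to \<open>h'\<close> would strictly
      lower the number of vertices.\<close>
    case (step g')
    then have "card (verts h') \<le> card (verts g')"
      using compatible_descendant tree_nodes_child base by blast
    then show ?thesis using card_child[OF base(2) step(1)] base(3) by simp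
  qed
next
  case (step g g1)
  have g1: "g1 \<in> tree_nodes A E ord" using tree_nodes_child step by blast
  note d1 = compatible_descendant[OF step.hyps(2) g1]
  from step.prems(1) show ?case
  proof (cases rule: converse_rtranclE)
    case base
    then show ?thesis using d1 card_child[OF step.prems(2) step.hyps(1)] step.prems(3) by simp
  next
    case (step g2)
    have g2: "g2 \<in> tree_nodes A E ord" using tree_nodes_child step(1) \<open>g \<in> _\<close> by blast
    note d2 = compatible_descendant[OF step(2) g2]
    have "g1 = g2"
    proof (rule compatible_child_unique[OF \<open>g \<in> _\<close> _ \<open>(g, g1) \<in> _\<close> _ step(1)])
      show "partition_on A (verts h)"
        using d1 tree_node_coalition_structure coalition_structuresD(1) by blast
    qed (use d1 d2 \<open>verts h = verts h'\<close> in auto)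
    then show ?thesis using step.IH g1 step(2) \<open>verts h = verts h'\<close> by blast
  qed
qed

text \<open>Existence comes from descending from the root, with which every structure is compatible;
  uniqueness is \<open>descendant_unique\<close> applied at the root.\<close>

lemma node_of:
  assumes "P \<in> coalition_structures A E"
  shows "node_of A E ord P \<in> tree_nodes A E ord" "verts (node_of A E ord P) = P"
proof -
  have root: "root_graph A E \<in> tree_nodes A E ord"
    unfolding tree_nodes_def descendants_def by simp
  then have "\<exists>h\<in>tree_nodes A E ord. verts h = P"
    using compatible_descendant_exists compatible_root assms by blast
  moreover have "h = h'"
    if "h \<in> tree_nodes A E ord" "h' \<in> tree_nodes A E ord" "verts h = verts h'" for h h'
    using descendant_unique[OF _ _ root that(3)] that(1,2) unfolding tree_nodes_def descendants_def
    by simp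
  ultimately have "\<exists>!h. h \<in> tree_nodes A E ord \<and> verts h = P" by metis
  then show "node_of A E ord P \<in> tree_nodes A E ord" "verts (node_of A E ord P) = P"
    using theI'[of "\<lambda>h. h \<in> tree_nodes A E ord \<and> verts h = P"] unfolding node_of_def by auto
qed

section \<open>The upper bound on a subtree\<close>

lemma ST_memberD:
  assumes "P \<in> coalition_structures A E" "Q \<in> ST A E ord P"
  shows "Q \<in> coalition_structures A E" "compatible (node_of A E ord P) Q"
  using assms compatible_descendant[OF _ node_of(1)] tree_node_coalition_structure
  unfolding ST_def descendants_def by auto

text \<open>A node is its own descendant, so the maximum ranges over a nonempty set.\<close>

lemma ST_self:
  assumes "P \<in> coalition_structures A E"
  shows "P \<in> ST A E ord P"
  using node_of(2)[OF assms] unfolding ST_def descendants_def by (force intro: image_eqI)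

lemma value_le_M_bound:
  assumes V: "mpa_decomposition A E V Vp Vm"
    and P: "P \<in> coalition_structures A E" and Q: "Q \<in> ST A E ord P"
  shows "V Q \<le> M_bound A E ord Vp Vm P"
proof -
  let ?g = "node_of A E ord P"
  have g: "well_formed_node A E ?g" using tree_node_well_formed node_of(1) P by blast
  note Q' = ST_memberD[OF P Q] and cl = green_closure_coalition_structure[OF g]
  \<comment> \<open>The witnesses represent \<open>Vp\<close> and \<open>Vm\<close> only on feasible
    structures, so \<open>P\<close>, \<open>Q\<close> and the closure must all be known to be
    feasible.\<close>
  obtain vp vm where vp: "superadditive A E vp" "\<forall>P\<in>coalition_structures A E. Vp P = sum vp P"
    and vm: "subadditive A E vm" "\<forall>P\<in>coalition_structures A E. Vm P = sum vm P"
    and sum: "V Q = Vp Q + Vm Q"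
    using V Q'(1) unfolding mpa_decomposition_def superadditive_cs_def subadditive_cs_def by blast
  have "\<forall>C\<in>P. \<exists>B\<in>Q. C \<subseteq> B" using Q'(2) node_of(2)[OF P] unfolding compatible_def by simp
  then have "sum vm Q \<le> sum vm P"
    using subadditive_refinement[OF finite_vertices vm(1) P Q'(1)] by blast
  moreover have "sum vp Q \<le> sum vp (green_closure ?g)"
    using superadditive_refinement[OF finite_vertices vp(1) cl Q'(1)]
      compatible_refines_green_closure[OF g Q'] by blast
  moreover have "cs_closure A E ord P = green_closure ?g"
    unfolding cs_closure_def green_closure_def Let_def ..
  ultimately show ?thesis
    using vp(2) vm(2) sum P Q'(1) cl unfolding M_bound_def by simp
qed

end

theorem theorem5p1:
  fixes A :: "'a set" and E :: "'a set set"
    and V Vp Vm :: "'a set set \<Rightarrow> real"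
    and ord :: "'a cgraph \<Rightarrow> 'a set set list"
    and CSi :: "'a set set"
  assumes "simple_graph A E"
    and "mpa_decomposition A E V Vp Vm"
    and "green_edge_order A E ord"
    and "CSi \<in> coalition_structures A E"
  shows "(\<forall>CSj\<in>ST A E ord CSi. V CSj \<le> M_bound A E ord Vp Vm CSi) \<and>
         M_bound A E ord Vp Vm CSi \<ge> Max {V CSj | CSj. CSj \<in> ST A E ord CSi}"
proof -
  interpret search_tree A E ord using assms by unfold_locales
  have bound: "\<forall>CSj\<in>ST A E ord CSi. V CSj \<le> M_bound A E ord Vp Vm CSi"
    using value_le_M_bound assms by blast
  \<comment> \<open>Finiteness, required for \<open>Max\<close>, is inherited from the finitely many
    coalition structures on \<open>A\<close>.\<close>
  have "ST A E ord CSi \<subseteq> coalition_structures A E" using ST_memberD(1) assms(4) by blast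
  then have "finite (ST A E ord CSi)"
    using finite_coalition_structures[OF finite_vertices] by (rule finite_subset)
  then have "finite {V CSj | CSj. CSj \<in> ST A E ord CSi}" by simp
  moreover have "{V CSj | CSj. CSj \<in> ST A E ord CSi} \<noteq> {}" using ST_self[OF assms(4)] by blast
  ultimately have "Max {V CSj | CSj. CSj \<in> ST A E ord CSi} \<le> M_bound A E ord Vp Vm CSi"
    using bound by (subst Max_le_iff) auto
  with bound show ?thesis by blast
qed

end
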